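(* Let $D_0$ be a two-row diagram whose nonempty rows are $r_1<r_2$. Then $\mathcal{P}(D_0)$ is bounded if and only if either $r_1=1$, or $r_1>1$ and $\mathrm{Col}^{\leftarrow}(D_0;r_1)=\emptyset$.
   Context: A diagram is a finite set $D$ of cells $(r,c)$ with $r,c$ positive integers; $r$ is the row (rows numbered from bottom to top starting at 1) and $c$ the column (numbered from left to right starting at 1). A Kohnert move at row $r$ applied to a diagram $D$: if row $r$ of $D$ is empty, $D$ is unchanged; otherwise let $(r,c)$ be the cell of row $r$ with the largest column index; if every position $(r',c)$ with $1\le r'<r$ belongs to $D$, then $D$ is unchanged; otherwise let $r'$ be the largest integer with $1\le r'<r$ and $(r',c)\notin D$, and the move replaces the cell $(r,c)$ by $(r',c)$. For a diagram $D_0$, $KD(D_0)$ is the set of all diagrams obtainable from $D_0$ by finite (possibly empty) sequences of Kohnert moves; the Kohnert poset $\mathcal{P}(D_0)$ is $KD(D_0)$ ordered by $D_2\preceq D_1$ iff $D_2$ can be obtained from $D_1$ by a finite sequence of Kohnert moves. A finite poset is bounded if it has a unique minimal element and a unique maximal element. A two-row diagram is a diagram with exactly two nonempty rows (not necessarily consecutive). For such $D_0$ with nonempty rows $r_1<r_2$: $\mathrm{Col}(D_0;r_1,r_2)$ is the set of columns containing cells in both rows; $\mathrm{Col}(D_0;r_1)$ is the set of columns containing a cell only in row $r_1$; $\mathrm{Col}^{\leftarrow}(D_0;r_1)=\{c\in\mathrm{Col}(D_0;r_1): c<\max\mathrm{Col}(D_0;r_1,r_2)\}$, taken to be empty when $\mathrm{Col}(D_0;r_1,r_2)=\emptyset$.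 *)

theory Defs
  imports Main
begin

(* A cell is a pair (row, column); rows are numbered from bottom to top, columns from left
   to right, both starting at 1. *)
type_synonym cell = "nat \<times> nat"

definition is_diagram :: "cell set \<Rightarrow> bool" where
  "is_diagram D \<longleftrightarrow> finite D \<and> (\<forall>(r, c) \<in> D. 1 \<le> r \<and> 1 \<le> c)"

definition row_cols :: "cell set \<Rightarrow> nat \<Rightarrow> nat set" where
  "row_cols D r = {c. (r, c) \<in> D}"

definition nonempty_rows :: "cell set \<Rightarrow> nat set" where
  "nonempty_rows D = {r. row_cols D r \<noteq> {}}"

definition kohnert_move :: "nat \<Rightarrow> cell set \<Rightarrow> cell set" where
  "kohnert_move r D =
     (if row_cols D r = {} then D
      else let c = Max (row_cols D r);
               free = {r'. 1 \<le> r' \<and> r' < r \<and> (r', c) \<notin> D}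
           in if free = {} then D
              else insert (Max free, c) (D - {(r, c)}))"

definition kohnert_step :: "cell set \<Rightarrow> cell set \<Rightarrow> bool" where
  "kohnert_step D D' \<longleftrightarrow> (\<exists>r \<ge> 1. D' = kohnert_move r D)"

definition KD :: "cell set \<Rightarrow> cell set set" where
  "KD D\<^sub>0 = {D. kohnert_step\<^sup>*\<^sup>* D\<^sub>0 D}"

(* The order relation of the Kohnert poset, as a set of pairs (smaller, larger) with
   carrier KD D0. *)
definition kohnert_poset :: "cell set \<Rightarrow> cell set rel" where
  "kohnert_poset D\<^sub>0 =
     {(D\<^sub>2, D\<^sub>1). D\<^sub>1 \<in> KD D\<^sub>0 \<and> D\<^sub>2 \<in> KD D\<^sub>0 \<and> kohnert_step\<^sup>*\<^sup>* D\<^sub>1 D\<^sub>2}"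

definition minimal_on :: "'a set \<Rightarrow> 'a rel \<Rightarrow> 'a \<Rightarrow> bool" where
  "minimal_on A r x \<longleftrightarrow> x \<in> A \<and> (\<forall>y \<in> A. (y, x) \<in> r \<longrightarrow> y = x)"

definition maximal_on :: "'a set \<Rightarrow> 'a rel \<Rightarrow> 'a \<Rightarrow> bool" where
  "maximal_on A r x \<longleftrightarrow> x \<in> A \<and> (\<forall>y \<in> A. (x, y) \<in> r \<longrightarrow> y = x)"

definition bounded_poset :: "'a set \<Rightarrow> 'a rel \<Rightarrow> bool" where
  "bounded_poset A r \<longleftrightarrow> finite A \<and> partial_order_on A r
     \<and> (\<exists>!x. minimal_on A r x) \<and> (\<exists>!x. maximal_on A r x)"

definition two_row_diagram :: "cell set \<Rightarrow> nat \<Rightarrow> nat \<Rightarrow> bool" where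
  "two_row_diagram D r\<^sub>1 r\<^sub>2 \<longleftrightarrow> is_diagram D \<and> r\<^sub>1 < r\<^sub>2 \<and> nonempty_rows D = {r\<^sub>1, r\<^sub>2}"

definition Col_both :: "cell set \<Rightarrow> nat \<Rightarrow> nat \<Rightarrow> nat set" where
  "Col_both D r\<^sub>1 r\<^sub>2 = {c. (r\<^sub>1, c) \<in> D \<and> (r\<^sub>2, c) \<in> D}"

definition Col_only :: "cell set \<Rightarrow> nat \<Rightarrow> nat set" where
  "Col_only D r = {c. (r, c) \<in> D \<and> (\<forall>r'. (r', c) \<in> D \<longrightarrow> r' = r)}"

definition Col_left :: "cell set \<Rightarrow> nat \<Rightarrow> nat \<Rightarrow> nat set" where
  "Col_left D r\<^sub>1 r\<^sub>2 =
     (if Col_both D r\<^sub>1 r\<^sub>2 = {} then {}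
      else {c \<in> Col_only D r\<^sub>1. c < Max (Col_both D r\<^sub>1 r\<^sub>2)})"

(* Sanity facts: for every diagram the carrier is finite and the relation above is a partial
   order, so these two conjuncts of bounded_poset are automatic for Kohnert posets. *)

lemma kohnert_move_cases:
  assumes "is_diagram D"
  obtains "kohnert_move r D = D"
  | c r' where "(r, c) \<in> D" "1 \<le> r'" "r' < r" "(r', c) \<notin> D"
      "kohnert_move r D = insert (r', c) (D - {(r, c)})"
proof (cases "kohnert_move r D = D")
  case False
  define c where "c = Max (row_cols D r)"
  define free where "free = {r'. 1 \<le> r' \<and> r' < r \<and> (r', c) \<notin> D}"
  have ne: "row_cols D r \<noteq> {}" "free \<noteq> {}"
    and eq: "kohnert_move r D = insert (Max free, c) (D - {(r, c)})"
    using False by (auto simp: kohnert_move_def Let_def c_def free_def split: if_splits)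
  have "row_cols D r \<subseteq> snd ` D" by (force simp: row_cols_def)
  then have "finite (row_cols D r)"
    using assms finite_surj is_diagram_def by blast
  then have c: "(r, c) \<in> D"
    using Max_in ne(1) unfolding c_def row_cols_def by blast
  have "finite free" unfolding free_def by simp
  then have "Max free \<in> free" using ne(2) by (rule Max_in)
  then show thesis using that(2)[OF c _ _ _ eq] unfolding free_def by blast
qed

lemma kohnert_step_invariants:
  assumes "is_diagram D" "kohnert_step D D'"
  shows "is_diagram D'" "D' = D \<or> (\<Sum>x\<in>D'. fst x) < (\<Sum>x\<in>D. fst x)"
    "D' \<subseteq> {..Max (insert 0 (fst ` D))} \<times> snd ` D"
proof -
  obtain r where r: "D' = kohnert_move r D"
    using assms(2) kohnert_step_def by blast
  have fin: "finite D" using assms(1) is_diagram_def by blast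
  then have le: "x \<in> D \<Longrightarrow> fst x \<le> Max (insert 0 (fst ` D))" for x by simp
  have sub: "D \<subseteq> {..Max (insert 0 (fst ` D))} \<times> snd ` D"
    using le by (intro subsetI) (simp add: mem_Times_iff imageI del: Max_insert)
  have "is_diagram D' \<and> (D' = D \<or> (\<Sum>x\<in>D'. fst x) < (\<Sum>x\<in>D. fst x)) \<and>
    D' \<subseteq> {..Max (insert 0 (fst ` D))} \<times> snd ` D"
  proof (rule kohnert_move_cases[OF assms(1), of r])
    assume "kohnert_move r D = D"
    then show ?thesis using r assms(1) sub by simp
  next
    fix c r' assume *: "(r, c) \<in> D" "1 \<le> r'" "r' < r" "(r', c) \<notin> D"
      "kohnert_move r D = insert (r', c) (D - {(r, c)})"
    have "1 \<le> c" using assms(1) *(1) unfolding is_diagram_def by auto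
    then have "is_diagram D'" using assms(1) *(2) unfolding is_diagram_def r *(5) by auto
    moreover have "(\<Sum>x\<in>D'. fst x) < (\<Sum>x\<in>D. fst x)"
      using *(3,4) fin sum.remove[OF fin *(1), of fst] unfolding r *(5) by simp
    moreover have "D' \<subseteq> {..Max (insert 0 (fst ` D))} \<times> snd ` D"
    proof -
      have "r' \<le> Max (insert 0 (fst ` D))" using le[OF *(1)] *(3) by simp
      moreover have "c \<in> snd ` D" using *(1) by (metis image_eqI snd_conv)
      ultimately show ?thesis using sub unfolding r *(5) by blast
    qed
    ultimately show ?thesis by blast
  qed
  then show "is_diagram D'" "D' = D \<or> (\<Sum>x\<in>D'. fst x) < (\<Sum>x\<in>D. fst x)"
    "D' \<subseteq> {..Max (insert 0 (fst ` D))} \<times> snd ` D" by blast+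
qed

lemma kohnert_steps_invariants:
  assumes "kohnert_step\<^sup>*\<^sup>* D D'" "is_diagram D"
  shows "is_diagram D' \<and> (D' = D \<or> (\<Sum>x\<in>D'. fst x) < (\<Sum>x\<in>D. fst x)) \<and>
    D' \<subseteq> {..Max (insert 0 (fst ` D))} \<times> snd ` D"
  using assms
proof (induction rule: rtranclp_induct)
  case base
  then have "finite D" using is_diagram_def by blast
  then have "x \<in> D \<Longrightarrow> fst x \<le> Max (insert 0 (fst ` D))" for x by simp
  then show ?case using base by force
next
  case (step D' D'')
  let ?m = "Max (insert 0 (fst ` D))"
  have D': "is_diagram D'" "D' = D \<or> (\<Sum>x\<in>D'. fst x) < (\<Sum>x\<in>D. fst x)"
    "D' \<subseteq> {..?m} \<times> snd ` D" using step by blast+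
  have fin: "finite D'" using D'(1) is_diagram_def by blast
  have "Max (insert 0 (fst ` D')) \<le> ?m" using D'(3) fin by auto
  moreover have "snd ` D' \<subseteq> snd ` D" using D'(3) by auto
  ultimately have "D'' \<subseteq> {..?m} \<times> snd ` D"
    using kohnert_step_invariants(3)[OF D'(1) step.hyps(2)] by fastforce
  then show ?case
    using kohnert_step_invariants(1,2)[OF D'(1) step.hyps(2)] D'(2) by auto
qed

lemma finite_KD:
  assumes "is_diagram D\<^sub>0"
  shows "finite (KD D\<^sub>0)"
proof -
  have "finite D\<^sub>0" using assms is_diagram_def by blast
  then have "finite (Pow ({..Max (insert 0 (fst ` D\<^sub>0))} \<times> snd ` D\<^sub>0))" by simp
  moreover have "KD D\<^sub>0 \<subseteq> Pow ({..Max (insert 0 (fst ` D\<^sub>0))} \<times> snd ` D\<^sub>0)"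
    using kohnert_steps_invariants[OF _ assms] unfolding KD_def by blast
  ultimately show ?thesis by (rule finite_subset[rotated])
qed

lemma partial_order_kohnert_poset:
  assumes "is_diagram D\<^sub>0"
  shows "partial_order_on (KD D\<^sub>0) (kohnert_poset D\<^sub>0)"
proof -
  have "antisym (kohnert_poset D\<^sub>0)"
  proof (rule antisymI)
    fix D D' assume *: "(D, D') \<in> kohnert_poset D\<^sub>0" "(D', D) \<in> kohnert_poset D\<^sub>0"
    then have "is_diagram D" "is_diagram D'"
      using kohnert_steps_invariants[OF _ assms] unfolding kohnert_poset_def KD_def by blast+
    then show "D = D'"
      using * kohnert_steps_invariants[of D D'] kohnert_steps_invariants[of D' D]
      unfolding kohnert_poset_def by auto
  qed
  moreover have "trans (kohnert_poset D\<^sub>0)"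
    unfolding trans_def kohnert_poset_def by auto
  ultimately show ?thesis
    unfolding partial_order_on_def preorder_on_def refl_on_def
    by (auto simp: kohnert_poset_def)
qed

end

theory Submission
  imports Defs
begin

text \<open>
  The diagram \<open>D\<^sub>0\<close> is always the only maximal element, and the minimal elements are the reachable
  diagrams fixed by every move. Moves preserve the number of cells in each column, which is at most
  two, so in a minimal element all cells lie in rows 1 and 2, and a cell in row 2 has a two-cell
  column weakly to its right. Hence minimal elements can only differ in the row (1 or 2) of the
  cell of a one-cell column \<open>d\<close> lying left of a two-cell column \<open>c\<close>. If that cell is weakly above
  column \<open>c\<close>, it remains so, because it moves one row at a time and never leaves a row that
  contains a cell of column \<open>c\<close>; so it ends in row 2. This settles the columns that start in row
  \<open>r\<^sub>2\<close>, and those starting in row \<open>r\<^sub>1 = 1\<close> never move. If \<open>r\<^sub>1 > 1\<close> and \<open>d\<close> starts in row \<open>r\<^sub>1\<close>,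
  both outcomes occur: exhausting the moves in rows below \<open>r\<^sub>2\<close> brings the cell to row 1, whereas
  exhausting the moves in rows above \<open>r\<^sub>1\<close> first brings all of column \<open>c\<close> weakly below it.
\<close>

section \<open>Columns as sets of row indices\<close>

definition column :: "cell set \<Rightarrow> nat \<Rightarrow> nat set" where
  "column D c = {r. (r, c) \<in> D}"

lemma mem_column: "r \<in> column D c \<longleftrightarrow> (r, c) \<in> D"
  by (simp add: column_def)

lemma finite_column: "is_diagram D \<Longrightarrow> finite (column D c)"
  by (rule finite_subset[of _ "fst ` D"]) (force simp: column_def is_diagram_def)+

lemma finite_row_cols: "is_diagram D \<Longrightarrow> finite (row_cols D r)"
  by (rule finite_subset[of _ "snd ` D"]) (force simp: row_cols_def is_diagram_def)+

lemma row_pos: "is_diagram D \<Longrightarrow> (r, c) \<in> D \<Longrightarrow> 1 \<le> r"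
  by (auto simp: is_diagram_def)

section \<open>Single moves\<close>

text \<open>Finer than \<open>kohnert_move_cases\<close>: it retains that the moving cell is
  rightmost and jumps only over occupied positions. The quantifier over \<open>d\<close> in the
  fixed case covers both reasons for a trivial move: it is vacuous for an empty row, and otherwise
  the blocking column is that of the rightmost cell.\<close>

lemma kohnert_move_rightmost_cases:
  assumes D: "is_diagram D"
  obtains (fixed) "kohnert_move r D = D"
      "\<And>d. (r, d) \<in> D \<Longrightarrow> \<exists>c\<ge>d. \<forall>s. 1 \<le> s \<and> s \<le> r \<longrightarrow> (s, c) \<in> D"
  | (moved) c r' where "kohnert_move r D \<noteq> D" "(r, c) \<in> D" "\<And>d. (r, d) \<in> D \<Longrightarrow> d \<le> c"
      "1 \<le> r'" "r' < r" "(r', c) \<notin> D" "\<And>s. r' < s \<Longrightarrow> s < r \<Longrightarrow> (s, c) \<in> D"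
      "kohnert_move r D = insert (r', c) (D - {(r, c)})"
proof (cases "row_cols D r = {}")
  case True
  then show thesis using fixed by (auto simp: kohnert_move_def row_cols_def)
next
  case False
  define c where "c = Max (row_cols D r)"
  define free where "free = {r'. 1 \<le> r' \<and> r' < r \<and> (r', c) \<notin> D}"
  have c: "(r, c) \<in> D" "\<And>d. (r, d) \<in> D \<Longrightarrow> d \<le> c"
    using Max_in[OF finite_row_cols[OF D] False] Max_ge[OF finite_row_cols[OF D]]
    by (auto simp: c_def row_cols_def)
  have eq: "kohnert_move r D = (if free = {} then D else insert (Max free, c) (D - {(r, c)}))"
    using False unfolding kohnert_move_def Let_def c_def[symmetric] free_def[symmetric] by simp
  show thesis
  proof (cases "free = {}")
    case True
    have "(s, c) \<in> D" if "1 \<le> s" "s \<le> r" for s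
      using True that c(1) unfolding free_def by (cases "s = r") auto
    then have "\<exists>c\<ge>d. \<forall>s. 1 \<le> s \<and> s \<le> r \<longrightarrow> (s, c) \<in> D" if "(r, d) \<in> D" for d
      using c(2)[OF that] by blast
    moreover have "kohnert_move r D = D" using eq True by simp
    ultimately show thesis by (rule fixed[rotated])
  next
    case ne: False
    have fin: "finite free" by (simp add: free_def)
    have M: "Max free \<in> free" using fin ne by (rule Max_in)
    have M': "1 \<le> Max free" "Max free < r" "(Max free, c) \<notin> D"
      using M unfolding free_def by blast+
    have eq': "kohnert_move r D = insert (Max free, c) (D - {(r, c)})"
      using eq ne by simp
    then have "kohnert_move r D \<noteq> D" using M'(3) by blast
    moreover have "(s, c) \<in> D" if "Max free < s" "s < r" for s
    proof (rule ccontr)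
      assume "(s, c) \<notin> D"
      then have "s \<in> free" using that by (simp add: free_def)
      then show False using Max_ge[OF fin] that by fastforce
    qed
    ultimately show thesis by (intro moved[OF _ c M' _ eq'])
  qed
qed

text \<open>Steps use rows from 1 on; with this fact later statements may range over all row
  indices.\<close>

lemma kohnert_move_0: "is_diagram D \<Longrightarrow> kohnert_move 0 D = D"
  by (auto simp: kohnert_move_def)

lemma kohnert_step_move: "is_diagram D \<Longrightarrow> kohnert_step\<^sup>*\<^sup>* D (kohnert_move r D)"
  by (cases "r = 0") (auto simp: kohnert_move_0 kohnert_step_def intro!: r_into_rtranclp exI[of _ r])

lemma is_diagram_kohnert_move: "is_diagram D \<Longrightarrow> is_diagram (kohnert_move r D)"
  using kohnert_steps_invariants[OF kohnert_step_move] by blast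

lemma card_column_kohnert_move:
  assumes "is_diagram D"
  shows "card (column (kohnert_move r D) d) = card (column D d)"
  using assms
proof (cases rule: kohnert_move_rightmost_cases[where D = D and r = r])
  case (moved c r')
  show ?thesis
  proof (cases "d = c")
    case True
    then have "column (kohnert_move r D) d = insert r' (column D c - {r})"
      using moved by (auto simp: column_def)
    moreover have "Suc (card (column D c - {r})) = card (column D c)"
      using moved finite_column[OF assms] by (intro card_Suc_Diff1) (auto simp: mem_column)
    ultimately show ?thesis
      using True moved finite_column[OF assms] by (simp add: mem_column)
  next
    case False
    then show ?thesis using moved by (simp add: column_def)
  qed
qed simp

lemma mem_kohnert_move:
  assumes "is_diagram D" "(s, d) \<in> D" "s \<noteq> r"
  shows "(s, d) \<in> kohnert_move r D"
  using assms(1) by (cases rule: kohnert_move_rightmost_cases[where D = D and r = r]) (use assms in auto)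

lemma row_1_kohnert_move:
  assumes "is_diagram D" "(1, d) \<in> D"
  shows "(1, d) \<in> kohnert_move r D"
  using assms(1) by (cases rule: kohnert_move_rightmost_cases[where D = D and r = r]) (use assms in auto)

text \<open>The inequality is weak because strictness can be lost: the single cell may descend into
  the top occupied row of column \<open>c\<close>.\<close>

definition single_above :: "nat \<Rightarrow> nat \<Rightarrow> cell set \<Rightarrow> bool" where
  "single_above d c D \<longleftrightarrow> (\<exists>r. column D d = {r} \<and> (\<forall>s\<in>column D c. s \<le> r))"

text \<open>A move in column \<open>c\<close> only lowers a cell there, and a move outside both
  columns changes nothing. The critical case is a move of the single cell itself.\<close>

lemma single_above_kohnert_move:
  assumes D: "is_diagram D" and dc: "d < c" and above: "single_above d c D"
  shows "single_above d c (kohnert_move r D)"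
  using D
proof (cases rule: kohnert_move_rightmost_cases[where D = D and r = r])
  case (moved e r')
  obtain a where a: "column D d = {a}" "\<forall>s\<in>column D c. s \<le> a"
    using above by (auto simp: single_above_def)
  consider "e = d" | "e = c" | "e \<noteq> d" "e \<noteq> c" by blast
  then show ?thesis
  proof cases
    case 1
    then have ra: "r = a" using moved(2) a(1) by (auto simp: column_def)
    \<comment> \<open>Jumping further would require a second cell of column \<open>d\<close> in row
      \<open>a - 1\<close>.\<close>
    have "r' = a - 1"
    proof (rule ccontr)
      assume "r' \<noteq> a - 1"
      then have "a - 1 \<in> column D d" "a - 1 \<noteq> a"
        using moved(5) moved(7)[of "a - 1"] ra 1 by (auto simp: mem_column)
      then show False using a(1) by simp
    qed
    moreover have "column (kohnert_move r D) d = {r'}"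
      using moved(8) 1 a(1) ra by (auto simp: column_def)
    moreover have "column (kohnert_move r D) c = column D c"
      using moved(8) 1 dc by (auto simp: column_def)
    moreover have "s \<le> a - 1" if "s \<in> column D c" for s
    proof -
      \<comment> \<open>The moving cell is rightmost in row \<open>a\<close> and
        \<open>d < c\<close>, so column \<open>c\<close> has no cell in that row.\<close>
      have "a \<notin> column D c" using moved(3)[of c] ra 1 dc by (auto simp: mem_column)
      then have "s \<noteq> a" using that by blast
      moreover have "s \<le> a" using a(2) that by blast
      ultimately show ?thesis by simp
    qed
    ultimately show ?thesis by (simp add: single_above_def)
  next
    case 2
    then have "column (kohnert_move r D) d = {a}"
      using moved(8) a(1) dc by (auto simp: column_def)
    moreover have "\<forall>s\<in>column (kohnert_move r D) c. s \<le> a"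
      using a(2) moved(2,5,8) 2 by (fastforce simp: column_def)
    ultimately show ?thesis by (auto simp: single_above_def)
  next
    case 3
    then have "column (kohnert_move r D) d = column D d" "column (kohnert_move r D) c = column D c"
      using moved(8) by (auto simp: column_def)
    then show ?thesis using a by (auto simp: single_above_def)
  qed
qed (use above in simp)

section \<open>Sequences of moves\<close>

text \<open>Induction rule for invariants that carries \<open>is_diagram\<close> along, as the
  lemmas on single moves require it.\<close>

lemma kohnert_steps_preserve [consumes 2]:
  assumes "kohnert_step\<^sup>*\<^sup>* D D'" "is_diagram D" "P D"
    and "\<And>E r. is_diagram E \<Longrightarrow> P E \<Longrightarrow> P (kohnert_move r E)"
  shows "P D'"
proof -
  have "is_diagram D' \<and> P D'"
    using assms(1)
    by (induction rule: rtranclp_induct)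
      (auto simp: assms kohnert_step_def is_diagram_kohnert_move)
  then show ?thesis ..
qed

lemma card_column_kohnert_steps:
  assumes "kohnert_step\<^sup>*\<^sup>* D D'" "is_diagram D"
  shows "card (column D' d) = card (column D d)"
  using assms by (induction rule: kohnert_steps_preserve) (auto simp: card_column_kohnert_move)

lemma row_1_kohnert_steps:
  assumes "kohnert_step\<^sup>*\<^sup>* D D'" "is_diagram D" "(1, d) \<in> D"
  shows "(1, d) \<in> D'"
  using assms(1,2)
  by (induction rule: kohnert_steps_preserve) (use assms(3) row_1_kohnert_move in auto)

lemma single_above_kohnert_steps:
  assumes "kohnert_step\<^sup>*\<^sup>* D D'" "is_diagram D" "d < c" "single_above d c D"
  shows "single_above d c D'"
  using assms(1,2)
  by (induction rule: kohnert_steps_preserve) (use assms(3,4) single_above_kohnert_move in auto)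

text \<open>Every nontrivial move lowers the sum of the row indices, so applying moves at rows in
  \<open>S\<close> as long as one has an effect must stop. The invariant \<open>P\<close> only has
  to survive moves at these rows.\<close>

lemma exhaust_kohnert_moves:
  assumes "is_diagram D" "P D"
    and "\<And>E r. is_diagram E \<Longrightarrow> P E \<Longrightarrow> r \<in> S \<Longrightarrow> P (kohnert_move r E)"
  obtains D' where "kohnert_step\<^sup>*\<^sup>* D D'" "P D'" "\<And>r. r \<in> S \<Longrightarrow> kohnert_move r D' = D'"
proof -
  have "\<exists>D'. kohnert_step\<^sup>*\<^sup>* D D' \<and> P D' \<and> (\<forall>r\<in>S. kohnert_move r D' = D')"
    using assms(1,2)
  proof (induction "\<Sum>x\<in>D. fst x" arbitrary: D rule: less_induct)
    case less
    show ?case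
    proof (cases "\<forall>r\<in>S. kohnert_move r D = D")
      case True
      then show ?thesis using less.prems by blast
    next
      case False
      then obtain r where r: "r \<in> S" "kohnert_move r D \<noteq> D" by blast
      have step: "kohnert_step\<^sup>*\<^sup>* D (kohnert_move r D)"
        using less.prems(1) by (rule kohnert_step_move)
      then have "(\<Sum>x\<in>kohnert_move r D. fst x) < (\<Sum>x\<in>D. fst x)"
        using kohnert_steps_invariants[OF step less.prems(1)] r(2) by blast
      then obtain D' where "kohnert_step\<^sup>*\<^sup>* (kohnert_move r D) D'" "P D'"
          "\<forall>r\<in>S. kohnert_move r D' = D'"
        using less.hyps[of "kohnert_move r D"] less.prems r(1) assms(3) is_diagram_kohnert_move
        by blast
      then show ?thesis using step by (meson rtranclp_trans)
    qed
  qed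
  then show thesis using that by blast
qed

section \<open>Minimal and maximal elements\<close>

definition terminal :: "cell set \<Rightarrow> bool" where
  "terminal D \<longleftrightarrow> (\<forall>r. kohnert_move r D = D)"

text \<open>A move at a minimal element leads to a smaller element, hence to itself; conversely, a
  terminal diagram reaches only itself.\<close>

lemma minimal_on_iff_terminal:
  assumes "is_diagram D\<^sub>0"
  shows "minimal_on (KD D\<^sub>0) (kohnert_poset D\<^sub>0) D \<longleftrightarrow> kohnert_step\<^sup>*\<^sup>* D\<^sub>0 D \<and> terminal D"
proof
  assume *: "minimal_on (KD D\<^sub>0) (kohnert_poset D\<^sub>0) D"
  then have D: "kohnert_step\<^sup>*\<^sup>* D\<^sub>0 D" by (simp add: minimal_on_def KD_def)
  then have "is_diagram D" using kohnert_steps_invariants assms by blast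
  then have "kohnert_step\<^sup>*\<^sup>* D (kohnert_move r D)" for r by (rule kohnert_step_move)
  then have "kohnert_move r D = D" for r
    using * D rtranclp_trans[OF D]
    unfolding minimal_on_def kohnert_poset_def KD_def by blast
  then show "kohnert_step\<^sup>*\<^sup>* D\<^sub>0 D \<and> terminal D" using D by (simp add: terminal_def)
next
  assume *: "kohnert_step\<^sup>*\<^sup>* D\<^sub>0 D \<and> terminal D"
  have "E = D" if "kohnert_step\<^sup>*\<^sup>* D E" for E
    using that
    by (induction rule: rtranclp_induct) (use * in \<open>auto simp: terminal_def kohnert_step_def\<close>)
  then show "minimal_on (KD D\<^sub>0) (kohnert_poset D\<^sub>0) D"
    using * by (auto simp: minimal_on_def KD_def kohnert_poset_def)
qed

lemma ex1_maximal_on: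
  assumes "is_diagram D\<^sub>0"
  shows "\<exists>!x. maximal_on (KD D\<^sub>0) (kohnert_poset D\<^sub>0) x"
proof (rule ex1I[of _ "D\<^sub>0"])
  have top: "(D, D\<^sub>0) \<in> kohnert_poset D\<^sub>0" if "D \<in> KD D\<^sub>0" for D
    using that by (auto simp: kohnert_poset_def KD_def)
  have D0: "D\<^sub>0 \<in> KD D\<^sub>0" by (simp add: KD_def)
  show "maximal_on (KD D\<^sub>0) (kohnert_poset D\<^sub>0) D\<^sub>0"
    using top D0 partial_order_kohnert_poset[OF assms]
    unfolding maximal_on_def partial_order_on_def antisym_def by blast
  show "x = D\<^sub>0" if "maximal_on (KD D\<^sub>0) (kohnert_poset D\<^sub>0) x" for x
    using that top D0 unfolding maximal_on_def by blast
qed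

text \<open>Finiteness, the order axioms and the unique maximal element hold for every diagram,
  which leaves the minimal elements to study.\<close>

lemma bounded_kohnert_poset_iff:
  assumes "is_diagram D\<^sub>0"
  shows "bounded_poset (KD D\<^sub>0) (kohnert_poset D\<^sub>0) \<longleftrightarrow>
    (\<exists>!D. kohnert_step\<^sup>*\<^sup>* D\<^sub>0 D \<and> terminal D)"
  using finite_KD[OF assms] partial_order_kohnert_poset[OF assms] ex1_maximal_on[OF assms]
  by (simp add: bounded_poset_def minimal_on_iff_terminal[OF assms])

lemma reachable_terminal:
  assumes "is_diagram D"
  obtains D' where "kohnert_step\<^sup>*\<^sup>* D D'" "terminal D'"
  using exhaust_kohnert_moves[OF assms, of "\<lambda>_. True" UNIV] by (auto simp: terminal_def)

text \<open>The rightmost cell of a fixed row sits on a column filled down to row 1. Hence the row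
  index is bounded by the size of a column, a quantity that moves preserve.\<close>

lemma fixed_row_le_card_column:
  assumes "is_diagram D" "kohnert_move r D = D" "(r, d) \<in> D"
  obtains c where "d \<le> c" "{1..r} \<subseteq> column D c" "r \<le> card (column D c)"
  using assms(1)
proof (cases rule: kohnert_move_rightmost_cases[where D = D and r = r])
  case fixed
  then obtain c where c: "d \<le> c" "{1..r} \<subseteq> column D c"
    using assms(3) by (force simp: mem_column)
  then show thesis using that card_mono[OF finite_column[OF assms(1)] c(2)] by simp
qed (use assms in simp)

lemma terminal_column_subset:
  assumes "is_diagram D" "terminal D" "\<And>c. card (column D c) \<le> 2"
  shows "column D d \<subseteq> {1, 2}"
proof
  fix r assume "r \<in> column D d"
  then have r: "(r, d) \<in> D" by (simp add: mem_column)
  moreover have "kohnert_move r D = D" using assms(2) by (simp add: terminal_def)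
  ultimately obtain c where "r \<le> card (column D c)"
    using fixed_row_le_card_column[OF assms(1)] by metis
  then show "r \<in> {1, 2}" using assms(3)[of c] row_pos[OF assms(1) r] by auto
qed

section \<open>Two-row diagrams\<close>

lemma two_row_diagram_mem:
  assumes "two_row_diagram D r\<^sub>1 r\<^sub>2" "(r, c) \<in> D"
  shows "r = r\<^sub>1 \<or> r = r\<^sub>2"
proof -
  have "r \<in> nonempty_rows D" using assms(2) by (auto simp: nonempty_rows_def row_cols_def)
  then show ?thesis using assms(1) by (simp add: two_row_diagram_def)
qed

lemma two_row_diagram_column:
  assumes "two_row_diagram D r\<^sub>1 r\<^sub>2"
  shows "column D c \<subseteq> {r\<^sub>1, r\<^sub>2}" "card (column D c) \<le> 2"
proof -
  show *: "column D c \<subseteq> {r\<^sub>1, r\<^sub>2}"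
    by (auto simp: mem_column dest: two_row_diagram_mem[OF assms])
  have "card (column D c) \<le> card {r\<^sub>1, r\<^sub>2}" using * by (intro card_mono) auto
  also have "\<dots> \<le> 2" by (simp add: card_insert_if)
  finally show "card (column D c) \<le> 2" .
qed

text \<open>Lying below the maximum of a finite nonempty set means lying below one of its elements,
  so \<open>Max\<close> and the case of an empty \<open>Col_both\<close> disappear.\<close>

lemma mem_Col_left_iff:
  assumes "two_row_diagram D r\<^sub>1 r\<^sub>2"
  shows "d \<in> Col_left D r\<^sub>1 r\<^sub>2 \<longleftrightarrow> column D d = {r\<^sub>1} \<and> (\<exists>c>d. column D c = {r\<^sub>1, r\<^sub>2})"
proof -
  have both: "c \<in> Col_both D r\<^sub>1 r\<^sub>2 \<longleftrightarrow> column D c = {r\<^sub>1, r\<^sub>2}" for c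
    using two_row_diagram_column(1)[OF assms, of c] by (auto simp: Col_both_def mem_column)
  have only: "d \<in> Col_only D r\<^sub>1 \<longleftrightarrow> column D d = {r\<^sub>1}"
    by (auto simp: Col_only_def column_def)
  have "finite (Col_both D r\<^sub>1 r\<^sub>2)"
    using finite_row_cols[of D r\<^sub>1] assms
    by (auto simp: Col_both_def row_cols_def two_row_diagram_def intro: rev_finite_subset)
  then show ?thesis
    using only both by (auto simp: Col_left_def Max_gr_iff)
qed

text \<open>Column sizes are invariant and terminal cells lie in rows 1 and 2, so two terminal
  diagrams can differ only in a one-cell column that is \<open>{1}\<close> in one and
  \<open>{2}\<close> in the other.\<close>

lemma terminal_unique:
  assumes two: "two_row_diagram D r\<^sub>1 r\<^sub>2" and cond: "r\<^sub>1 = 1 \<or> Col_left D r\<^sub>1 r\<^sub>2 = {}"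
    and x: "kohnert_step\<^sup>*\<^sup>* D x" "terminal x" and y: "kohnert_step\<^sup>*\<^sup>* D y" "terminal y"
  shows "x = y"
proof -
  have D: "is_diagram D" "r\<^sub>1 < r\<^sub>2" using two by (auto simp: two_row_diagram_def)
  have card_le: "card (column E c) \<le> 2" if "kohnert_step\<^sup>*\<^sup>* D E" for E c
    using card_column_kohnert_steps[OF that D(1)] two_row_diagram_column(2)[OF two] by simp
  have sub: "column E c \<subseteq> {1, 2}" if E: "kohnert_step\<^sup>*\<^sup>* D E" "terminal E" for E c
    using terminal_column_subset card_le[OF E(1)] E kohnert_steps_invariants[OF E(1) D(1)] by blast
  have no_conflict: False
    if E: "kohnert_step\<^sup>*\<^sup>* D E" "terminal E" "column E d = {2}"
      and F: "kohnert_step\<^sup>*\<^sup>* D F" "terminal F" "column F d = {1}" for E F d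
  proof -
    have "(2, d) \<in> E" using E(3) by (auto simp: column_def)
    moreover have "is_diagram E" using kohnert_steps_invariants E(1) D(1) by blast
    \<comment> \<open>The cell of \<open>E\<close> in row 2 is held up by a two-cell column
      \<open>c\<close>; it lies strictly right of \<open>d\<close>, and it had two cells in
      \<open>D\<close> already.\<close>
    ultimately obtain c where c: "d \<le> c" "{1..2} \<subseteq> column E c" "2 \<le> card (column E c)"
      using fixed_row_le_card_column[of E 2 d] E(2) by (metis terminal_def)
    have "c \<noteq> d" using c(3) E(3) by auto
    then have dc: "d < c" using c(1) by simp
    have cardc: "card (column D c) = 2"
      using c(3) card_le[OF E(1), of c] card_column_kohnert_steps[OF E(1) D(1), of c] by simp
    then have colc: "column D c = {r\<^sub>1, r\<^sub>2}"
      using two_row_diagram_column(1)[OF two] D(2) by (intro card_subset_eq) auto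
    have "card (column F c) = 2" using card_column_kohnert_steps[OF F(1) D(1)] cardc by simp
    then have "column F c = {1, 2}" using sub[OF F(1,2)] by (intro card_subset_eq) auto
    \<comment> \<open>In \<open>F\<close> column \<open>c\<close> reaches row 2 while column
      \<open>d\<close> has only a cell in row 1.\<close>
    then have not_above: "\<not> single_above d c F" using F(3) by (auto simp: single_above_def)
    have "card (column D d) = 1"
      using card_column_kohnert_steps[OF E(1) D(1), of d] E(3) by simp
    then consider "column D d = {r\<^sub>1}" | "column D d = {r\<^sub>2}"
      using two_row_diagram_column(1)[OF two, of d] by (auto simp: card_1_singleton_iff)
    then show False
    proof cases
      case 1
      then have "r\<^sub>1 = 1" using cond mem_Col_left_iff[OF two, of d] colc dc by auto
      then have "(1, d) \<in> D" using 1 by (auto simp: column_def)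
      then have "(1, d) \<in> E" using row_1_kohnert_steps E(1) D(1) by blast
      then show False using E(3) by (simp flip: mem_column)
    next
      case 2
      then have "single_above d c D" using colc D(2) by (auto simp: single_above_def)
      then show False using single_above_kohnert_steps[OF F(1) D(1) dc] not_above by blast
    qed
  qed
  have "column x d = column y d" for d
  proof -
    have "card (column x d) = card (column y d)"
      using card_column_kohnert_steps x(1) y(1) D(1) by metis
    moreover have "column x d \<in> {{}, {1}, {2}, {1, 2}}" "column y d \<in> {{}, {1}, {2}, {1, 2}}"
      using sub[OF x, of d] sub[OF y, of d] by blast+
    ultimately show ?thesis
      using no_conflict[OF x _ y, of d] no_conflict[OF y _ x, of d] by auto
  qed
  then show "x = y" unfolding column_def by auto
qed

text \<open>First only rows below \<open>r\<^sub>2\<close> are moved. There each column has at most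
  one cell, so nothing can be blocked above row 1. Once the cell of column \<open>d\<close> is in
  row 1, it stays there under all further moves.\<close>

lemma terminal_row_1:
  assumes two: "two_row_diagram D r\<^sub>1 r\<^sub>2" and d: "column D d = {r\<^sub>1}"
  obtains D' where "kohnert_step\<^sup>*\<^sup>* D D'" "terminal D'" "(1, d) \<in> D'"
proof -
  have D: "is_diagram D" "r\<^sub>1 < r\<^sub>2" using two by (auto simp: two_row_diagram_def)
  define P where "P E \<longleftrightarrow> (\<exists>r<r\<^sub>2. (r, d) \<in> E) \<and>
    (\<forall>c s t. (s, c) \<in> E \<longrightarrow> (t, c) \<in> E \<longrightarrow> s < r\<^sub>2 \<longrightarrow> t < r\<^sub>2 \<longrightarrow> s = t)" for E
  have "P D"
    unfolding P_def
  proof (intro conjI allI impI)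
    show "\<exists>r<r\<^sub>2. (r, d) \<in> D" using d D(2) by (auto simp: column_def)
    show "s = t" if "(s, c) \<in> D" "(t, c) \<in> D" "s < r\<^sub>2" "t < r\<^sub>2" for c s t
      using that two_row_diagram_mem[OF two] by (metis less_irrefl)
  qed
  moreover have "P (kohnert_move r E)" if "is_diagram E" "P E" "r \<in> {..<r\<^sub>2}" for E r
    using that(1)
  proof (cases rule: kohnert_move_rightmost_cases[where D = E and r = r])
    case (moved c r')
    obtain a where a: "a < r\<^sub>2" "(a, d) \<in> E" using \<open>P E\<close> by (auto simp: P_def)
    have uniq: "s = t" if "(s, c) \<in> E" "(t, c) \<in> E" "s < r\<^sub>2" "t < r\<^sub>2" for s t c
      using that \<open>P E\<close> unfolding P_def by blast
    have "\<exists>r''<r\<^sub>2. (r'', d) \<in> kohnert_move r E"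
    proof (cases "(a, d) = (r, c)")
      case True
      then show ?thesis using moved(5,8) a(1) by (intro exI[of _ r']) auto
    qed (use a moved(8) in auto)
    moreover have "s = t"
      if st: "(s, e) \<in> kohnert_move r E" "(t, e) \<in> kohnert_move r E" "s < r\<^sub>2" "t < r\<^sub>2" for e s t
    proof (cases "e = c")
      case True
      have "x = r'" if "(x, c) \<in> kohnert_move r E" "x < r\<^sub>2" for x
        using that moved(8) uniq[of x c r] moved(2) \<open>r \<in> {..<r\<^sub>2}\<close> by auto
      then show ?thesis using st True by metis
    next
      case False
      then show ?thesis using st moved(8) uniq by auto
    qed
    ultimately show ?thesis unfolding P_def by blast
  qed (use that in simp)
  ultimately obtain E where E: "kohnert_step\<^sup>*\<^sup>* D E" "P E" "\<And>r. r < r\<^sub>2 \<Longrightarrow> kohnert_move r E = E"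
    using exhaust_kohnert_moves[OF D(1), of P "{..<r\<^sub>2}"] by auto
  have diagE: "is_diagram E" using kohnert_steps_invariants E(1) D(1) by blast
  obtain a where a: "a < r\<^sub>2" "(a, d) \<in> E" using E(2) by (auto simp: P_def)
  \<comment> \<open>A column filled from row 1 to row \<open>a\<close> with at most one cell below
    row \<open>r\<^sub>2\<close> forces \<open>a = 1\<close>.\<close>
  then obtain c where "{1..a} \<subseteq> column E c"
    using fixed_row_le_card_column[OF diagE E(3)] by metis
  then have "(1, c) \<in> E" "(a, c) \<in> E"
    using row_pos[OF diagE a(2)] by (auto simp: column_def)
  then have "a = 1"
    using E(2) a(1) row_pos[OF diagE a(2)] unfolding P_def by (meson le_less_trans)
  then have "(1, d) \<in> E" using a(2) by simp
  moreover obtain D' where "kohnert_step\<^sup>*\<^sup>* E D'" "terminal D'"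
    using reachable_terminal[OF diagE] .
  ultimately show thesis
    using that row_1_kohnert_steps[OF _ diagE] rtranclp_trans[OF E(1)] by blast
qed

text \<open>First only rows above \<open>r\<^sub>1\<close> are moved, which leaves the cell of
  column \<open>d\<close> in place and brings all others weakly below it. From then on
  \<open>single_above d c\<close> is invariant, and two cells of column \<open>c\<close> do not fit
  into row 1.\<close>

lemma terminal_not_row_1:
  assumes two: "two_row_diagram D r\<^sub>1 r\<^sub>2" and r1: "1 < r\<^sub>1" and d: "column D d = {r\<^sub>1}"
    and c: "column D c = {r\<^sub>1, r\<^sub>2}" "d < c"
  obtains D' where "kohnert_step\<^sup>*\<^sup>* D D'" "terminal D'" "(1, d) \<notin> D'"
proof -
  have D: "is_diagram D" "r\<^sub>1 < r\<^sub>2" using two by (auto simp: two_row_diagram_def)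
  have "(r\<^sub>1, d) \<in> D" using d by (auto simp: column_def)
  moreover have "(r\<^sub>1, d) \<in> kohnert_move r E"
    if "is_diagram E" "(r\<^sub>1, d) \<in> E" "r \<in> {r\<^sub>1<..}" for E r
    using mem_kohnert_move[OF that(1,2)] that(3) by simp
  ultimately obtain E where E: "kohnert_step\<^sup>*\<^sup>* D E" "(r\<^sub>1, d) \<in> E"
      "\<And>r. r > r\<^sub>1 \<Longrightarrow> kohnert_move r E = E"
    using exhaust_kohnert_moves[OF D(1), of "\<lambda>E. (r\<^sub>1, d) \<in> E" "{r\<^sub>1<..}"] by auto
  have diagE: "is_diagram E" using kohnert_steps_invariants E(1) D(1) by blast
  have card: "card (column E e) = card (column D e)" for e
    using card_column_kohnert_steps E(1) D(1) by blast
  have low: "s \<le> r\<^sub>1" if "s \<in> column E e" for s e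
  proof (rule ccontr)
    assume "\<not> s \<le> r\<^sub>1"
    then have "r\<^sub>1 < s" "(s, e) \<in> E" using that by (auto simp: mem_column)
    \<comment> \<open>A fixed cell in row \<open>s\<close> requires a column with at least
      \<open>s\<close> cells, but \<open>s > r\<^sub>1 \<ge> 2\<close> and columns have at most
      two.\<close>
    then obtain e' where "s \<le> card (column E e')"
      using fixed_row_le_card_column[OF diagE E(3)] by metis
    then show False
      using card two_row_diagram_column(2)[OF two, of e'] \<open>\<not> s \<le> r\<^sub>1\<close> r1 by simp
  qed
  have "card (column E d) = 1" using card d by simp
  then obtain a where "column E d = {a}" by (auto simp: card_1_singleton_iff)
  then have "column E d = {r\<^sub>1}" using E(2) mem_column[of r\<^sub>1 E d] by simp
  then have above: "single_above d c E" using low by (auto simp: single_above_def)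
  obtain D' where D': "kohnert_step\<^sup>*\<^sup>* E D'" "terminal D'"
    using reachable_terminal[OF diagE] .
  have DD': "kohnert_step\<^sup>*\<^sup>* D D'" using E(1) D'(1) by (rule rtranclp_trans)
  have diagD': "is_diagram D'" using kohnert_steps_invariants DD' D(1) by blast
  have "(1, d) \<notin> D'"
  proof
    assume "(1, d) \<in> D'"
    moreover obtain r where "column D' d = {r}" "\<forall>s\<in>column D' c. s \<le> r"
      using single_above_kohnert_steps[OF D'(1) diagE c(2) above] by (auto simp: single_above_def)
    ultimately have "\<forall>s\<in>column D' c. s \<le> 1" by (auto simp: column_def)
    moreover have "1 \<le> s" if "s \<in> column D' c" for s
      using row_pos[OF diagD'] that unfolding mem_column .
    ultimately have "column D' c \<subseteq> {1}" by (auto simp: order_antisym)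
    then have "card (column D' c) \<le> card {1::nat}" by (intro card_mono) auto
    moreover have "card (column D' c) = 2"
      using card_column_kohnert_steps[OF DD' D(1)] c(1) D(2) by simp
    ultimately show False by simp
  qed
  then show thesis using that DD' D'(2) by blast
qed

theorem theorem5p5:
  fixes D\<^sub>0 :: "cell set" and r\<^sub>1 r\<^sub>2 :: nat
  assumes "two_row_diagram D\<^sub>0 r\<^sub>1 r\<^sub>2"
  shows "bounded_poset (KD D\<^sub>0) (kohnert_poset D\<^sub>0) \<longleftrightarrow>
    r\<^sub>1 = 1 \<or> (r\<^sub>1 > 1 \<and> Col_left D\<^sub>0 r\<^sub>1 r\<^sub>2 = {})"
proof -
  have D: "is_diagram D\<^sub>0" using assms by (simp add: two_row_diagram_def)
  have "r\<^sub>1 \<in> nonempty_rows D\<^sub>0" using assms by (simp add: two_row_diagram_def)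
  then have r1: "1 \<le> r\<^sub>1" using row_pos[OF D] by (auto simp: nonempty_rows_def row_cols_def)
  show ?thesis
    unfolding bounded_kohnert_poset_iff[OF D]
  proof
    assume unique: "\<exists>!D. kohnert_step\<^sup>*\<^sup>* D\<^sub>0 D \<and> terminal D"
    show "r\<^sub>1 = 1 \<or> (r\<^sub>1 > 1 \<and> Col_left D\<^sub>0 r\<^sub>1 r\<^sub>2 = {})"
    proof (rule ccontr)
      assume "\<not> ?thesis"
      \<comment> \<open>Such a \<open>d\<close> yields two reachable terminal diagrams that differ
        at position \<open>(1, d)\<close>.\<close>
      then obtain d c where "1 < r\<^sub>1" and d: "column D\<^sub>0 d = {r\<^sub>1}"
          and "column D\<^sub>0 c = {r\<^sub>1, r\<^sub>2}" "d < c"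
        using r1 mem_Col_left_iff[OF assms] by (metis equals0I nat_less_le)
      then show False
        using terminal_row_1[OF assms d] terminal_not_row_1[OF assms] unique by metis
    qed
  next
    assume "r\<^sub>1 = 1 \<or> (r\<^sub>1 > 1 \<and> Col_left D\<^sub>0 r\<^sub>1 r\<^sub>2 = {})"
    then show "\<exists>!D. kohnert_step\<^sup>*\<^sup>* D\<^sub>0 D \<and> terminal D"
      using terminal_unique[OF assms] reachable_terminal[OF D] by metis
  qed
qed

end
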